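(* Let $(\rho(\theta))_{\theta\in\mathbb{R}^L}$ be a second-order differentiable parameterized family of positive definite states on a finite-dimensional Hilbert space. Then for all $\alpha\in(0,1)\cup(1,\infty)$ and all $\theta\in\mathbb{R}^L$, the geometric information matrix equals the RLD information matrix: $$\widehat I_\alpha(\theta)=I_{\mathrm{RLD}}(\theta).$$
   Context: A state is a positive semi-definite operator of unit trace. For positive definite states $\rho,\sigma$ and $\alpha\in(0,1)\cup(1,\infty)$, the geometric Rényi relative entropy is $\widehat D_\alpha(\rho\|\sigma):=\frac{1}{\alpha-1}\ln\mathrm{Tr}[\sigma(\sigma^{-1/2}\rho\sigma^{-1/2})^\alpha]=\frac{1}{\alpha-1}\ln\mathrm{Tr}[\rho(\rho^{-1/2}\sigma\rho^{-1/2})^{1-\alpha}]$. The geometric information matrix has entries $[\widehat I_\alpha(\theta)]_{i,j}:=\frac1\alpha\left.\frac{\partial^2}{\partial\varepsilon_i\partial\varepsilon_j}\widehat D_\alpha(\rho(\theta)\|\rho(\theta+\varepsilon))\right|_{\varepsilon=0}$. The right-logarithmic derivative (RLD) information matrix has entries $[I_{\mathrm{RLD}}(\theta)]_{i,j}:=\mathrm{Re}\,\mathrm{Tr}[(\partial_i\rho(\theta))\rho(\theta)^{-1}(\partial_j\rho(\theta))]=\frac12\mathrm{Tr}[\{\partial_i\rho(\theta),\partial_j\rho(\theta)\}\rho(\theta)^{-1}]$, where $\partial_i=\partial/\partial\theta_i$ and $\{A,B\}=AB+BA$. *)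

theory Defs
  imports "HOL-Analysis.Analysis"
begin

text \<open>
  Operators on a finite-dimensional complex Hilbert space are represented by square complex
  matrices over an arbitrary finite (nonempty) index type.
\<close>

definition conj_transpose :: "complex^'n^'m \<Rightarrow> complex^'m^'n" where
  "conj_transpose A = (\<chi> i j. cnj (A $ j $ i))"

definition hermitian :: "complex^'n^'n \<Rightarrow> bool" where
  "hermitian A \<longleftrightarrow> conj_transpose A = A"

definition unitary :: "complex^'n^'n \<Rightarrow> bool" where
  "unitary U \<longleftrightarrow> conj_transpose U ** U = mat 1 \<and> U ** conj_transpose U = mat 1"

definition quad_form :: "complex^'n^'n \<Rightarrow> complex^'n \<Rightarrow> complex" where
  "quad_form A x = (\<Sum>i\<in>UNIV. cnj (x $ i) * (A *v x) $ i)"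

text \<open>For hermitian \<open>A\<close> the form is real-valued, so taking real parts loses nothing.\<close>

definition pos_semidef :: "complex^'n^'n \<Rightarrow> bool" where
  "pos_semidef A \<longleftrightarrow> hermitian A \<and> (\<forall>x. 0 \<le> Re (quad_form A x))"

definition pos_def :: "complex^'n^'n \<Rightarrow> bool" where
  "pos_def A \<longleftrightarrow> hermitian A \<and> (\<forall>x. x \<noteq> 0 \<longrightarrow> 0 < Re (quad_form A x))"

definition state :: "complex^'n^'n \<Rightarrow> bool" where
  "state A \<longleftrightarrow> pos_semidef A \<and> trace A = 1"

definition real_diag :: "('n \<Rightarrow> real) \<Rightarrow> complex^'n^'n" where
  "real_diag d = (\<chi> i j. if i = j then complex_of_real (d i) else 0)"

text \<open>
  Functional calculus of hermitian matrices. The result does not depend on the chosen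
  diagonalization, see \<open>matrix_fun_eqI\<close> below; on matrices that are not hermitian
  the value is unspecified.
\<close>

definition matrix_fun :: "(real \<Rightarrow> real) \<Rightarrow> complex^'n^'n \<Rightarrow> complex^'n^'n" where
  "matrix_fun f A = (THE B. \<exists>U d. unitary U \<and> A = U ** real_diag d ** conj_transpose U \<and>
     B = U ** real_diag (\<lambda>i. f (d i)) ** conj_transpose U)"

definition matrix_powr :: "complex^'n^'n \<Rightarrow> real \<Rightarrow> complex^'n^'n" where
  "matrix_powr A s = matrix_fun (\<lambda>x. x powr s) A"

lemma real_diag_mult_left: "(real_diag d ** A) $ i $ j = complex_of_real (d i) * A $ i $ j"
proof -
  have "(real_diag d ** A) $ i $ j =
      (\<Sum>k\<in>UNIV. if i = k then complex_of_real (d i) * A $ k $ j else 0)"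
    unfolding matrix_matrix_mult_def real_diag_def vec_lambda_beta
    by (intro sum.cong) auto
  then show ?thesis
    by simp
qed

lemma real_diag_mult_right: "(A ** real_diag d) $ i $ j = A $ i $ j * complex_of_real (d j)"
proof -
  have "(A ** real_diag d) $ i $ j =
      (\<Sum>k\<in>UNIV. if k = j then A $ i $ k * complex_of_real (d j) else 0)"
    unfolding matrix_matrix_mult_def real_diag_def vec_lambda_beta
    by (intro sum.cong) auto
  then show ?thesis
    by simp
qed

lemma diagonalization_fun_unique:
  fixes U V :: "complex^'n^'n"
  assumes U: "unitary U" and V: "unitary V"
    and eq: "U ** real_diag d ** conj_transpose U = V ** real_diag e ** conj_transpose V"
  shows "U ** real_diag (\<lambda>i. f (d i)) ** conj_transpose U =
    V ** real_diag (\<lambda>i. f (e i)) ** conj_transpose V"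
proof -
  define W where "W = conj_transpose V ** U"
  have UU: "conj_transpose U ** U = mat 1" "U ** conj_transpose U = mat 1"
    and VV: "conj_transpose V ** V = mat 1" "V ** conj_transpose V = mat 1"
    using U V by (auto simp: unitary_def)
  have "W ** real_diag d = W ** real_diag d ** (conj_transpose U ** U)"
    by (simp only: UU matrix_mul_rid)
  also have "\<dots> = conj_transpose V ** (U ** real_diag d ** conj_transpose U) ** U"
    by (simp only: W_def matrix_mul_assoc)
  also have "\<dots> = (conj_transpose V ** V) ** real_diag e ** W"
    by (simp only: eq W_def matrix_mul_assoc)
  finally have W: "W ** real_diag d = real_diag e ** W"
    by (simp only: VV matrix_mul_lid)
  have fW: "W ** real_diag (\<lambda>i. f (d i)) = real_diag (\<lambda>i. f (e i)) ** W"
  proof -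
    have "W $ i $ j * complex_of_real (f (d j)) = complex_of_real (f (e i)) * W $ i $ j" for i j
    proof (cases "W $ i $ j = 0")
      case False
      have "W $ i $ j * complex_of_real (d j) = complex_of_real (e i) * W $ i $ j"
        using W by (simp only: flip: real_diag_mult_left real_diag_mult_right)
      with False have "d j = e i"
        by simp
      then show ?thesis
        by simp
    qed simp
    then show ?thesis
      by (simp add: vec_eq_iff real_diag_mult_left real_diag_mult_right)
  qed
  have VW: "V ** W = U"
    by (simp only: W_def matrix_mul_assoc VV matrix_mul_lid)
  have WU: "W ** conj_transpose U = conj_transpose V"
    by (simp only: W_def UU matrix_mul_rid flip: matrix_mul_assoc)
  have "U ** real_diag (\<lambda>i. f (d i)) ** conj_transpose U =
      V ** (W ** real_diag (\<lambda>i. f (d i))) ** conj_transpose U"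
    by (simp only: VW matrix_mul_assoc)
  also have "\<dots> = V ** real_diag (\<lambda>i. f (e i)) ** (W ** conj_transpose U)"
    by (simp only: fW matrix_mul_assoc)
  finally show ?thesis
    by (simp only: WU)
qed

lemma matrix_fun_eqI:
  assumes "unitary U" and "A = U ** real_diag d ** conj_transpose U"
  shows "matrix_fun f A = U ** real_diag (\<lambda>i. f (d i)) ** conj_transpose U"
  unfolding matrix_fun_def
proof (rule the_equality)
  show "\<exists>V e. unitary V \<and> A = V ** real_diag e ** conj_transpose V \<and>
      U ** real_diag (\<lambda>i. f (d i)) ** conj_transpose U =
      V ** real_diag (\<lambda>i. f (e i)) ** conj_transpose V"
    by (intro exI[of _ U] exI[of _ d] conjI assms refl)
next
  fix B
  assume "\<exists>V e. unitary V \<and> A = V ** real_diag e ** conj_transpose V \<and>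
      B = V ** real_diag (\<lambda>i. f (e i)) ** conj_transpose V"
  then obtain V e where V: "unitary V" "A = V ** real_diag e ** conj_transpose V"
    and B: "B = V ** real_diag (\<lambda>i. f (e i)) ** conj_transpose V"
    by blast
  show "B = U ** real_diag (\<lambda>i. f (d i)) ** conj_transpose U"
    unfolding B
    by (rule diagonalization_fun_unique[OF V(1) assms(1) trans[OF V(2)[symmetric] assms(2)]])
qed

text \<open>
  For positive definite arguments the trace is a positive real number, so \<open>Re\<close> is only a cast.
\<close>

definition geometric_renyi_entropy :: "real \<Rightarrow> complex^'n^'n \<Rightarrow> complex^'n^'n \<Rightarrow> real" where
  "geometric_renyi_entropy \<alpha> \<rho> \<sigma> = 1 / (\<alpha> - 1) * ln (Re (trace
     (\<sigma> ** matrix_powr (matrix_powr \<sigma> (-1/2) ** \<rho> ** matrix_powr \<sigma> (-1/2)) \<alpha>)))"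

definition partial_deriv ::
    "'l \<Rightarrow> (real^'l \<Rightarrow> 'a::real_normed_vector) \<Rightarrow> real^'l \<Rightarrow> 'a" where
  "partial_deriv i F x = vector_derivative (\<lambda>t. F (x + t *\<^sub>R axis i 1)) (at 0)"

text \<open>Twice Frechet differentiable everywhere; the second derivative need not be continuous.\<close>

definition twice_differentiable ::
    "('a::real_normed_vector \<Rightarrow> 'b::real_normed_vector) \<Rightarrow> bool" where
  "twice_differentiable F \<longleftrightarrow> (\<exists>F' :: 'a \<Rightarrow> 'a \<Rightarrow>\<^sub>L 'b. \<forall>x.
     (F has_derivative blinfun_apply (F' x)) (at x) \<and> F' differentiable (at x))"

definition geometric_info_matrix ::
    "real \<Rightarrow> (real^'l \<Rightarrow> complex^'n^'n) \<Rightarrow> real^'l \<Rightarrow> real^'l^'l" where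
  "geometric_info_matrix \<alpha> \<rho> \<theta> = (\<chi> i j. 1 / \<alpha> *
     partial_deriv i (partial_deriv j
       (\<lambda>\<epsilon>. geometric_renyi_entropy \<alpha> (\<rho> \<theta>) (\<rho> (\<theta> + \<epsilon>)))) 0)"

definition RLD_info_matrix ::
    "(real^'l \<Rightarrow> complex^'n^'n) \<Rightarrow> real^'l \<Rightarrow> real^'l^'l" where
  "RLD_info_matrix \<rho> \<theta> = (\<chi> i j. Re (trace
     (partial_deriv i \<rho> \<theta> ** matrix_inv (\<rho> \<theta>) ** partial_deriv j \<rho> \<theta>)))"

end

theory Submission
  imports Defs
begin

text \<open>
  Write \<open>\<rho> = \<rho>(\<theta>)\<close>, \<open>\<sigma> = \<rho>(\<theta> + \<epsilon>)\<close> and \<open>\<Delta> = \<sigma> - \<rho>\<close>. Diagonalizing \<open>\<rho>\<close> and \<open>\<sigma>\<close> simultaneously by a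
  congruence gives, for small \<open>\<Delta>\<close>,
  \<open>Tr[\<sigma> (\<sigma>\<^sup>-\<^sup>1\<^sup>/\<^sup>2 \<rho> \<sigma>\<^sup>-\<^sup>1\<^sup>/\<^sup>2)\<^sup>\<alpha>] = (\<Sum>k. ((1 - \<alpha>) gchoose k) Tr[(\<Delta> \<rho>\<^sup>-\<^sup>1)\<^sup>k \<rho>])\<close>.
  The term for \<open>k = 0\<close> is \<open>1\<close> and the term for \<open>k = 1\<close> is \<open>Tr \<Delta> = 0\<close>, because all traces are \<open>1\<close>; the terms with
  \<open>k \<ge> 3\<close> sum up to a function whose derivative is \<open>O(\<Delta>\<^sup>2)\<close>, so they do not contribute to second
  derivatives at \<open>\<epsilon> = 0\<close>. The Hessian comes from \<open>k = 2\<close> alone: it is \<open>\<alpha> (\<alpha> - 1)\<close> times the RLD matrix.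
  As the first derivatives vanish, the logarithm does not change it.
\<close>

section \<open>Conjugate transposes, real diagonal matrices and traces\<close>

lemma conj_transpose_mult: "conj_transpose (A ** B) = conj_transpose B ** conj_transpose A"
  by (simp add: conj_transpose_def matrix_matrix_mult_def vec_eq_iff mult.commute)

lemma conj_transpose_conj_transpose [simp]: "conj_transpose (conj_transpose A) = A"
  by (simp add: conj_transpose_def vec_eq_iff)

lemma conj_transpose_real_diag [simp]: "conj_transpose (real_diag d) = real_diag d"
  by (simp add: conj_transpose_def real_diag_def vec_eq_iff)

lemma conj_transpose_mat_1 [simp]: "conj_transpose (mat 1 :: complex^'n^'n) = mat 1"
  by (simp add: conj_transpose_def mat_def vec_eq_iff)

lemma real_diag_mult: "real_diag d ** real_diag e = real_diag (\<lambda>i. d i * e i)"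
  unfolding vec_eq_iff real_diag_mult_left by (simp add: real_diag_def)

lemma real_diag_one: "real_diag (\<lambda>i. 1) = mat 1"
  by (simp add: real_diag_def mat_def vec_eq_iff)

lemma real_diag_diff: "real_diag d - real_diag e = real_diag (\<lambda>i. d i - e i)"
  by (simp add: real_diag_def vec_eq_iff)

lemma trace_conj_transpose: "trace (conj_transpose A) = cnj (trace A)"
  by (simp add: trace_def conj_transpose_def)

text \<open>Only the squared norms of the columns of \<open>T\<close> survive as weights, and they
  do not depend on \<open>g\<close>. Traces of functions of a diagonalized operator thus become
  weighted sums of scalars.\<close>

lemma trace_congruence_real_diag:
  "Re (trace (T ** real_diag g ** conj_transpose T)) =
    (\<Sum>i\<in>UNIV. g i * (\<Sum>j\<in>UNIV. (cmod (T $ j $ i))\<^sup>2))"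
proof -
  have "Re (trace (T ** real_diag g ** conj_transpose T)) =
      (\<Sum>j\<in>UNIV. \<Sum>i\<in>UNIV. g i * (cmod (T $ j $ i))\<^sup>2)"
    unfolding trace_def matrix_matrix_mult_def[of "T ** real_diag g"]
    by (simp add: real_diag_mult_right conj_transpose_def cmod_power2 algebra_simps
        flip: power2_eq_square)
  also have "\<dots> = (\<Sum>i\<in>UNIV. \<Sum>j\<in>UNIV. g i * (cmod (T $ j $ i))\<^sup>2)"
    by (rule sum.swap)
  finally show ?thesis
    by (simp add: sum_distrib_left)
qed

lemma matrix_diff_ldistrib: "A ** (B - C) = A ** B - A ** C"
  for A :: "'a::comm_ring_1^'n^'m"
  by (simp add: matrix_matrix_mult_def vec_eq_iff sum_subtractf algebra_simps)

lemma matrix_diff_rdistrib: "(A - B) ** C = A ** C - B ** C"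
  for C :: "'a::comm_ring_1^'n^'m"
  by (simp add: matrix_matrix_mult_def vec_eq_iff sum_subtractf algebra_simps)

subsection \<open>Spectral theorem for hermitian matrices\<close>

text \<open>The real \<open>inner\<close> on complex vectors is the real part of this form
  (\<open>Re_cinner\<close>). The real one serves norms and maximization, the complex one expresses
  the orthogonality that a unitary matrix needs.\<close>

definition cinner :: "complex^'n \<Rightarrow> complex^'n \<Rightarrow> complex" where
  "cinner x y = (\<Sum>i\<in>UNIV. cnj (x $ i) * y $ i)"

lemma cinner_add_right: "cinner x (y + z) = cinner x y + cinner x z"
  by (simp add: cinner_def algebra_simps sum.distrib)

lemma cinner_scaleR_right: "cinner x (c *\<^sub>R y) = of_real c * cinner x y"
  unfolding cinner_def sum_distrib_left
  by (intro sum.cong) (auto simp: scaleR_conv_of_real[where 'a = complex])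

lemma cinner_commute: "cinner y x = cnj (cinner x y)"
  by (simp add: cinner_def mult.commute)

lemma Re_cinner: "Re (cinner x y) = x \<bullet> y"
  by (simp add: cinner_def inner_vec_def inner_complex_def)

lemma cinner_self: "cinner x x = complex_of_real ((norm x)\<^sup>2)"
proof (rule complex_eqI)
  show "Re (cinner x x) = Re (complex_of_real ((norm x)\<^sup>2))"
    by (simp add: Re_cinner dot_square_norm)
  show "Im (cinner x x) = Im (complex_of_real ((norm x)\<^sup>2))"
    by (simp add: cinner_def mult.commute)
qed

lemma cinner_matrix_left: "cinner (A *v x) y = cinner x (conj_transpose A *v y)"
proof -
  have "cinner (A *v x) y = (\<Sum>i\<in>UNIV. \<Sum>j\<in>UNIV. cnj (A $ i $ j) * cnj (x $ j) * y $ i)"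
    by (simp add: cinner_def matrix_vector_mult_def sum_distrib_right)
  also have "\<dots> = (\<Sum>j\<in>UNIV. \<Sum>i\<in>UNIV. cnj (A $ i $ j) * cnj (x $ j) * y $ i)"
    by (rule sum.swap)
  also have "\<dots> = cinner x (conj_transpose A *v y)"
    by (simp add: cinner_def matrix_vector_mult_def conj_transpose_def sum_distrib_left mult_ac)
  finally show ?thesis .
qed

lemma cinner_hermitian: "hermitian A \<Longrightarrow> cinner (A *v x) y = cinner x (A *v y)"
  by (simp add: cinner_matrix_left hermitian_def)

lemma Re_quad_form: "Re (quad_form A x) = x \<bullet> (A *v x)"
  by (simp add: quad_form_def Re_cinner flip: cinner_def)

lemma linear_matrix_vector: "linear ((*v) (A :: complex^'n^'m))"
  by (rule matrix_vector_mul_linear)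

text \<open>A maximizer of the Rayleigh quotient is an eigenvector.\<close>

lemma hermitian_eigenvector_in_orthogonal_complement:
  fixes A :: "complex^'n^'n" and v :: "'i \<Rightarrow> complex^'n"
  assumes A: "hermitian A" and v: "\<And>i. i \<in> S \<Longrightarrow> A *v v i = d i *\<^sub>R v i"
    and x0: "x0 \<noteq> 0" "\<And>i. i \<in> S \<Longrightarrow> cinner (v i) x0 = 0"
  obtains x c where "norm x = 1" "\<And>i. i \<in> S \<Longrightarrow> cinner (v i) x = 0" "A *v x = c *\<^sub>R x"
proof -
  define W where "W = {x. \<forall>i\<in>S. cinner (v i) x = 0}"
  have W_add: "x + y \<in> W" and W_scale: "r *\<^sub>R x \<in> W" if "x \<in> W" "y \<in> W" for x y r
    using that by (auto simp: W_def cinner_add_right cinner_scaleR_right)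
  have "W = (\<Inter>i\<in>S. {x. cinner (v i) x = 0})"
    by (auto simp: W_def)
  moreover have "closed {x. cinner (v i) x = 0}" for i
    unfolding cinner_def by (intro closed_Collect_eq continuous_intros)
  ultimately have "closed W"
    by auto
  then have comp: "compact (sphere 0 1 \<inter> W)"
    by (intro compact_Int_closed) auto
  have "(1 / norm x0) *\<^sub>R x0 \<in> sphere 0 1 \<inter> W"
    using x0 by (auto simp: W_def cinner_scaleR_right)
  then have ne: "sphere 0 1 \<inter> W \<noteq> {}"
    by blast
  have "continuous_on (sphere 0 1 \<inter> W) (\<lambda>x. x \<bullet> (A *v x))"
    by (intro continuous_intros linear_continuous_on linear_conv_bounded_linear[THEN iffD1]
        linear_matrix_vector)
  from continuous_attains_sup[OF comp ne this] obtain x where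
    x: "norm x = 1" "x \<in> W" and max: "\<And>y. norm y = 1 \<Longrightarrow> y \<in> W \<Longrightarrow> y \<bullet> (A *v y) \<le> x \<bullet> (A *v x)"
    by auto
  define c where "c = x \<bullet> (A *v x)"
  have max': "z \<bullet> (A *v z) \<le> c * (z \<bullet> z)" if "z \<in> W" for z
  proof (cases "z = 0")
    case False
    have "((1 / norm z) *\<^sub>R z) \<bullet> (A *v ((1 / norm z) *\<^sub>R z)) \<le> c"
      unfolding c_def using False W_scale[OF that that] by (intro max) auto
    then show ?thesis
      using False
      by (simp add: linear_scale[OF linear_matrix_vector] dot_square_norm power2_eq_square divide_simps)
  qed simp
  define y where "y = A *v x - c *\<^sub>R x"
  \<comment> \<open>\<open>W\<close> is invariant under \<open>A\<close>: moving the hermitian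
    \<open>A\<close> to the other side lets it act on \<open>v i\<close>, which only contributes the
    factor \<open>d i\<close>.\<close>
  have "A *v x \<in> W"
    using x(2) v A by (auto simp: W_def cinner_commute[of "A *v x"] cinner_scaleR_right
        cinner_hermitian[symmetric] cinner_commute[of _ x])
  then have "y \<in> W"
    using W_add[of "A *v x" "(-c) *\<^sub>R x"] W_scale[OF x(2) x(2), of "-c"] by (simp add: y_def)
  have sa: "x \<bullet> (A *v y) = (A *v x) \<bullet> y"
    using cinner_hermitian[OF A] by (simp flip: Re_cinner)
  define K where "K = c * (y \<bullet> y) - y \<bullet> (A *v y)"
  \<comment> \<open>Maximality is tested at \<open>x + t *\<^sub>R y\<close>. The constant terms
    cancel and the terms linear in \<open>t\<close> combine to
    \<open>2 * t * (y \<bullet> y)\<close>, so dividing by \<open>t\<close> leaves this bound.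
    Letting \<open>t\<close> tend to 0 forces the residual \<open>y\<close> to vanish.\<close>
  have "2 * (y \<bullet> y) \<le> t * K" if "t > 0" for t
  proof -
    have "(x + t *\<^sub>R y) \<bullet> (A *v (x + t *\<^sub>R y)) \<le> c * ((x + t *\<^sub>R y) \<bullet> (x + t *\<^sub>R y))"
      by (intro max' W_add x W_scale[OF \<open>y \<in> W\<close> \<open>y \<in> W\<close>])
    moreover have "x \<bullet> x = 1"
      using x(1) by (simp add: dot_square_norm)
    ultimately have "c + 2 * t * ((A *v x) \<bullet> y) + t * (t * (y \<bullet> (A *v y))) \<le>
        c * (1 + 2 * t * (x \<bullet> y) + t * (t * (y \<bullet> y)))"
      by (simp add: matrix_vector_right_distrib linear_scale[OF linear_matrix_vector] inner_add_left
          inner_add_right sa c_def[symmetric] inner_commute algebra_simps)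
    moreover have "y \<bullet> y = (A *v x) \<bullet> y - c * (x \<bullet> y)"
      by (subst y_def) (simp add: inner_diff_left)
    then have "t * (2 * (y \<bullet> y)) = t * (2 * ((A *v x) \<bullet> y - c * (x \<bullet> y)))"
      by (simp only:)
    ultimately have "t * (2 * (y \<bullet> y)) \<le> t * (t * K)"
      unfolding K_def by (simp add: algebra_simps)
    with that show ?thesis
      by simp
  qed
  then have "\<forall>\<^sub>F t in at_right 0. 2 * (y \<bullet> y) \<le> t * K"
    by (auto simp: eventually_at_filter)
  moreover have "((\<lambda>t. t * K) \<longlongrightarrow> 0 * K) (at_right 0)"
    by (intro tendsto_intros)
  ultimately have "2 * (y \<bullet> y) \<le> 0 * K"
    by (intro tendsto_lowerbound[of "\<lambda>t. t * K" _ "at_right 0"]) auto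
  then have "\<not> 0 < y \<bullet> y"
    by (simp del: inner_gt_zero_iff)
  then have "y = 0"
    by (simp only: inner_gt_zero_iff not_not)
  then have "A *v x = c *\<^sub>R x"
    by (simp add: y_def)
  with x that show thesis
    by (auto simp: W_def)
qed

text \<open>Induction over the index set: each step adds an eigenvector orthogonal to those already
  chosen. Because the indices are those of the matrix, the family for \<open>S = UNIV\<close> can
  serve as the columns of a unitary matrix.\<close>

lemma hermitian_orthonormal_eigenvectors:
  fixes A :: "complex^'n^'n"
  assumes A: "hermitian A"
  shows "\<exists>(v :: 'n \<Rightarrow> complex^'n) d. (\<forall>i\<in>S. A *v v i = d i *\<^sub>R v i) \<and>
    (\<forall>i\<in>S. \<forall>j\<in>S. cinner (v i) (v j) = (if i = j then 1 else 0))"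
  using finite[of S]
proof (induction S)
  case (insert k S)
  then obtain v :: "'n \<Rightarrow> complex^'n" and d where
    v: "\<And>i. i \<in> S \<Longrightarrow> A *v v i = d i *\<^sub>R v i"
    "\<And>i j. i \<in> S \<Longrightarrow> j \<in> S \<Longrightarrow> cinner (v i) (v j) = (if i = j then 1 else 0)"
    by blast
  \<comment> \<open>The rows in \<open>S\<close> are the conjugated eigenvectors, the others are
    zero. Row \<open>k\<close> is a zero row, so \<open>B\<close> is singular, and a nonzero kernel
    vector is orthogonal to every \<open>v i\<close> with \<open>i\<close> in
    \<open>S\<close>.\<close>
  define B :: "complex^'n^'n" where "B = (\<chi> i j. if i \<in> S then cnj (v i $ j) else 0)"
  have "row k B = 0"
    using insert.hyps by (simp add: B_def row_def vec_eq_iff)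
  then have "det B = 0"
    by (rule det_zero_row)
  then have "\<not> (\<exists>C. C ** B = mat 1)"
    by (metis invertible_det_nz invertible_left_inverse)
  then obtain x0 where x0: "x0 \<noteq> 0" "B *v x0 = 0"
    unfolding matrix_left_invertible_ker by blast
  have "cinner (v i) x0 = 0" if "i \<in> S" for i
    using arg_cong[OF x0(2), of "\<lambda>z. z $ i"] that
    by (simp add: B_def matrix_vector_mult_def cinner_def)
  with A v(1) x0(1) obtain x c where
    x: "norm x = 1" "\<And>i. i \<in> S \<Longrightarrow> cinner (v i) x = 0" "A *v x = c *\<^sub>R x"
    using hermitian_eigenvector_in_orthogonal_complement[of A S v d x0] by blast
  have "cinner x (v i) = 0" if "i \<in> S" for i
    using x(2)[OF that] by (simp add: cinner_commute[of x])
  with insert.hyps v x show ?case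
    by (intro exI[of _ "v(k := x)"] exI[of _ "d(k := c)"]) (auto simp: cinner_self[of x])
qed simp

lemma hermitian_diagonalization:
  fixes A :: "complex^'n^'n"
  assumes "hermitian A"
  obtains U d where "unitary U" "A = U ** real_diag d ** conj_transpose U"
proof -
  obtain v :: "'n \<Rightarrow> complex^'n" and d where
    v: "\<And>i. A *v v i = d i *\<^sub>R v i" "\<And>i j. cinner (v i) (v j) = (if i = j then 1 else 0)"
    using hermitian_orthonormal_eigenvectors[OF assms, of UNIV] by auto
  define U :: "complex^'n^'n" where "U = (\<chi> i j. v j $ i)"
  have 1: "conj_transpose U ** U = mat 1"
    using v(2) by (simp add: vec_eq_iff matrix_matrix_mult_def conj_transpose_def U_def mat_def
        cinner_def)
  then have 2: "U ** conj_transpose U = mat 1"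
    by (simp add: matrix_left_right_inverse)
  have "(A ** U) $ i $ j = (U ** real_diag d) $ i $ j" for i j
    using arg_cong[OF v(1)[of j], of "\<lambda>z. z $ i"] unfolding real_diag_mult_right
    by (simp add: matrix_matrix_mult_def matrix_vector_mult_def U_def scaleR_conv_of_real[where 'a = complex] mult.commute)
  then have "A ** U = U ** real_diag d"
    by (simp add: vec_eq_iff)
  then have "U ** real_diag d ** conj_transpose U = A ** (U ** conj_transpose U)"
    by (simp add: matrix_mul_assoc)
  with 1 2 show thesis
    by (intro that[of U d]) (auto simp: unitary_def)
qed

subsection \<open>Positive definite matrices\<close>

lemma pos_def_congruence:
  assumes A: "pos_def A" and T: "invertible (conj_transpose T)"
  shows "pos_def (T ** A ** conj_transpose T)"
proof -
  have "0 < Re (quad_form (T ** A ** conj_transpose T) x)" if "x \<noteq> 0" for x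
  proof -
    have "conj_transpose T *v x \<noteq> 0"
      using T that by (metis invertible_def matrix_left_invertible_ker)
    moreover have "Re (quad_form (T ** A ** conj_transpose T) x) =
        Re (quad_form A (conj_transpose T *v x))"
      by (simp only: quad_form_def flip: cinner_def)
        (simp add: cinner_matrix_left flip: matrix_vector_mul_assoc)
    ultimately show ?thesis
      using A by (simp add: pos_def_def)
  qed
  moreover have "hermitian (T ** A ** conj_transpose T)"
    using A by (simp add: pos_def_def hermitian_def conj_transpose_mult matrix_mul_assoc)
  ultimately show ?thesis
    by (simp add: pos_def_def)
qed

lemma unitary_invertible: "unitary U \<Longrightarrow> invertible U" "unitary U \<Longrightarrow> invertible (conj_transpose U)"
  by (auto simp: unitary_def invertible_def)

lemma pos_def_diagonalization:
  fixes A :: "complex^'n^'n"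
  assumes A: "pos_def A"
  obtains U d where "unitary U" "A = U ** real_diag d ** conj_transpose U" "\<And>i. 0 < d i"
proof -
  obtain U d where U: "unitary U" and eq: "A = U ** real_diag d ** conj_transpose U"
    using hermitian_diagonalization[of A] A unfolding pos_def_def by blast
  have UU: "conj_transpose U ** U = mat 1"
    using U by (simp add: unitary_def)
  have "conj_transpose U ** A ** U = (conj_transpose U ** U) ** real_diag d ** (conj_transpose U ** U)"
    by (simp only: eq matrix_mul_assoc)
  also have "\<dots> = real_diag d"
    by (simp only: UU matrix_mul_lid matrix_mul_rid)
  finally have pd: "pos_def (real_diag d)"
    using pos_def_congruence[OF A, of "conj_transpose U"] unitary_invertible(1)[OF U] by simp
  have "0 < d i" for i
  proof -
    have "0 < Re (quad_form (real_diag d) (axis i 1))"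
      using pd by (simp add: pos_def_def axis_eq_0_iff)
    also have "quad_form (real_diag d) (axis i 1) =
        (\<Sum>j\<in>UNIV. if j = i then complex_of_real (d i) else 0)"
      unfolding quad_form_def matrix_vector_mult_def real_diag_def axis_def
      by (intro sum.cong) (auto simp: if_distrib[of "\<lambda>x. _ * x"] cong: if_cong)
    finally show ?thesis
      by simp
  qed
  with U eq that show thesis
    by blast
qed

text \<open>
  With \<open>T = \<sigma> powr (1/2) U\<close>, where \<open>U\<close> diagonalizes \<open>\<sigma> powr (-1/2) \<rho> \<sigma> powr (-1/2)\<close>, the two
  states are diagonalized simultaneously by a congruence.
\<close>

lemma simultaneous_diagonalization_geometric:
  fixes \<rho> \<sigma> :: "complex^'n^'n"
  assumes "pos_def \<rho>" "pos_def \<sigma>"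
  obtains T :: "complex^'n^'n" and d :: "'n \<Rightarrow> real" where "invertible T" "\<And>i. 0 < d i" "\<sigma> = T ** conj_transpose T"
    "\<rho> = T ** real_diag d ** conj_transpose T"
    "\<And>\<alpha>. trace (\<sigma> ** matrix_powr (matrix_powr \<sigma> (-1/2) ** \<rho> ** matrix_powr \<sigma> (-1/2)) \<alpha>) =
      trace (T ** real_diag (\<lambda>i. d i powr \<alpha>) ** conj_transpose T)"
proof -
  obtain V s where V: "unitary V" and \<sigma>: "\<sigma> = V ** real_diag s ** conj_transpose V"
    and s: "\<And>i. 0 < s i"
    using pos_def_diagonalization[OF assms(2)] by blast
  \<comment> \<open>The real powers of \<sigma> in its eigenbasis. Their group law
    \<open>P_mult\<close> replaces computations with \<open>matrix_powr\<close>.\<close>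
  define P where "P x = V ** real_diag (\<lambda>i. s i powr x) ** conj_transpose V" for x
  have VV: "conj_transpose V ** V = mat 1" "V ** conj_transpose V = mat 1"
    using V by (auto simp: unitary_def)
  have P_mult: "P x ** P y = P (x + y)" for x y
  proof -
    have "P x ** P y = V ** real_diag (\<lambda>i. s i powr x) ** (conj_transpose V ** V) **
        real_diag (\<lambda>i. s i powr y) ** conj_transpose V"
      by (simp only: P_def matrix_mul_assoc)
    also have "\<dots> = V ** (real_diag (\<lambda>i. s i powr x) ** real_diag (\<lambda>i. s i powr y)) ** conj_transpose V"
      by (simp only: VV matrix_mul_rid matrix_mul_assoc)
    finally show ?thesis
      by (simp add: P_def real_diag_mult powr_add)
  qed
  have P_0: "P 0 = mat 1" and P_1: "P 1 = \<sigma>"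
    using s VV by (simp_all add: P_def \<sigma> real_diag_one less_imp_neq[symmetric] less_imp_le)
  have P_herm: "conj_transpose (P x) = P x" for x
    by (simp add: P_def conj_transpose_mult matrix_mul_assoc)
  have powr: "matrix_powr \<sigma> x = P x" for x
    unfolding matrix_powr_def P_def by (rule matrix_fun_eqI[OF V \<sigma>])
  define M where "M = P (-1/2) ** \<rho> ** P (-1/2)"
  have inv: "P (1/2) ** P (-1/2) = mat 1" "P (-1/2) ** P (1/2) = mat 1"
    by (simp_all add: P_mult P_0)
  have "pos_def M"
    using pos_def_congruence[OF assms(1), of "P (-1/2)"] inv
    by (auto simp: P_herm M_def invertible_def)
  then obtain U d where U: "unitary U" and M: "M = U ** real_diag d ** conj_transpose U"
    and d: "\<And>i. 0 < d i"
    using pos_def_diagonalization by blast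
  have UU: "conj_transpose U ** U = mat 1" "U ** conj_transpose U = mat 1"
    using U by (auto simp: unitary_def)
  define T where "T = P (1/2) ** U"
  have T': "conj_transpose T = conj_transpose U ** P (1/2)"
    by (simp add: T_def conj_transpose_mult P_herm)
  show thesis
  proof (rule that[of T d])
    show "invertible T"
      unfolding T_def using inv unitary_invertible(1)[OF U]
      by (intro invertible_mult) (auto simp: invertible_def)
    show "0 < d i" for i
      by fact
    have "T ** conj_transpose T = P (1/2) ** (U ** conj_transpose U) ** P (1/2)"
      unfolding T' by (simp only: T_def matrix_mul_assoc)
    then show "\<sigma> = T ** conj_transpose T"
      by (simp add: UU P_mult P_1)
    have "T ** real_diag d ** conj_transpose T = P (1/2) ** M ** P (1/2)"
      unfolding T' by (simp only: T_def M matrix_mul_assoc)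
    also have "\<dots> = (P (1/2) ** P (-1/2)) ** \<rho> ** (P (-1/2) ** P (1/2))"
      by (simp only: M_def matrix_mul_assoc)
    also have "\<dots> = \<rho>"
      by (simp only: inv matrix_mul_lid matrix_mul_rid)
    finally show "\<rho> = T ** real_diag d ** conj_transpose T" ..
    show "trace (\<sigma> ** matrix_powr (matrix_powr \<sigma> (-1/2) ** \<rho> ** matrix_powr \<sigma> (-1/2)) \<alpha>) =
        trace (T ** real_diag (\<lambda>i. d i powr \<alpha>) ** conj_transpose T)" for \<alpha>
    proof -
      define E where "E = U ** real_diag (\<lambda>i. d i powr \<alpha>) ** conj_transpose U"
      have "matrix_powr M \<alpha> = E"
        unfolding matrix_powr_def E_def by (rule matrix_fun_eqI[OF U M])
      then have "\<sigma> ** matrix_powr (matrix_powr \<sigma> (-1/2) ** \<rho> ** matrix_powr \<sigma> (-1/2)) \<alpha> = P 1 ** E"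
        by (simp only: powr P_1 flip: M_def)
      \<comment> \<open>\<sigma> splits into two square roots, and cyclicity of the trace carries
        one of them to the right of \<open>E\<close>, which yields the congruence by
        \<open>T\<close>.\<close>
      also have "P 1 ** E = P (1/2) ** (P (1/2) ** E)"
        by (simp add: P_mult matrix_mul_assoc)
      also have "trace \<dots> = trace (P (1/2) ** E ** P (1/2))"
        by (rule trace_mul_sym)
      finally show ?thesis
        unfolding T' by (simp add: T_def E_def matrix_mul_assoc)
    qed
  qed
qed

subsection \<open>Power series in a bounded bilinear operation\<close>

text \<open>For \<open>b X Y = X ** matrix_inv \<rho> ** Y\<close> and \<open>v = \<rho>\<close> the
  k-th iterate is \<open>(D \<rho>\<^sup>-\<^sup>1)\<^sup>k \<rho>\<close>, the operator whose trace
  appears in the binomial expansion.\<close>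

primrec iter_op :: "('a \<Rightarrow> 'b \<Rightarrow> 'b) \<Rightarrow> 'b \<Rightarrow> nat \<Rightarrow> 'a \<Rightarrow> 'b" where
  "iter_op b v 0 D = v"
| "iter_op b v (Suc k) D = b D (iter_op b v k D)"

primrec iter_op_deriv ::
    "('a \<Rightarrow> 'b \<Rightarrow> 'b::real_vector) \<Rightarrow> 'b \<Rightarrow> nat \<Rightarrow> 'a \<Rightarrow> 'a \<Rightarrow> 'b" where
  "iter_op_deriv b v 0 D H = 0"
| "iter_op_deriv b v (Suc k) D H = b D (iter_op_deriv b v k D H) + b H (iter_op b v k D)"

lemma iter_op_has_derivative:
  assumes "bounded_bilinear b"
  shows "(iter_op b v k has_derivative iter_op_deriv b v k D) (at D within S)"
proof (induction k)
  case 0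
  show ?case
    by simp
next
  case (Suc k)
  show ?case
    using bounded_bilinear.FDERIV[OF assms has_derivative_ident Suc.IH] by simp
qed

text \<open>Differentiating replaces one of the k factors \<open>D\<close> by \<open>H\<close> and
  leaves k - 1 of them. For k = 0 the truncated exponent does no harm, since the factor
  \<open>real k\<close> is 0.\<close>

lemma iter_op_bounds:
  assumes K: "0 \<le> K" "\<And>x y. norm (b x y) \<le> K * norm x * norm y"
  shows "norm (iter_op b v k D) \<le> (K * norm D) ^ k * norm v"
    and "norm (iter_op_deriv b v k D H) \<le> real k * K ^ k * norm D ^ (k - 1) * norm H * norm v"
proof -
  show 1: "norm (iter_op b v k D) \<le> (K * norm D) ^ k * norm v" for k
  proof (induction k)
    case (Suc k)
    have "norm (iter_op b v (Suc k) D) \<le> K * norm D * norm (iter_op b v k D)"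
      using K by simp
    also have "\<dots> \<le> K * norm D * ((K * norm D) ^ k * norm v)"
      using Suc K by (intro mult_left_mono) auto
    finally show ?case
      by (simp add: mult_ac)
  qed simp
  show "norm (iter_op_deriv b v k D H) \<le> real k * K ^ k * norm D ^ (k - 1) * norm H * norm v"
  proof (induction k)
    case (Suc k)
    have "norm (b D (iter_op_deriv b v k D H)) \<le> K * norm D * norm (iter_op_deriv b v k D H)"
      by (rule K)
    also have "\<dots> \<le> K * norm D * (real k * K ^ k * norm D ^ (k - 1) * norm H * norm v)"
      using Suc K by (intro mult_left_mono) auto
    also have "\<dots> = real k * K ^ Suc k * norm D ^ k * norm H * norm v"
      by (cases k) auto
    finally have a: "norm (b D (iter_op_deriv b v k D H)) \<le> \<dots>" .
    have "norm (b H (iter_op b v k D)) \<le> K * norm H * norm (iter_op b v k D)"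
      by (rule K)
    also have "\<dots> \<le> K * norm H * ((K * norm D) ^ k * norm v)"
      using 1 K by (intro mult_left_mono) auto
    also have "\<dots> = K ^ Suc k * norm D ^ k * norm H * norm v"
      by (simp add: power_mult_distrib)
    finally have c: "norm (b H (iter_op b v k D)) \<le> \<dots>" .
    show ?case
      using norm_triangle_mono[OF a c] by (simp add: algebra_simps)
  qed simp
qed

text \<open>The derivative of a term of degree at least 3 keeps at least two factors
  \<open>D\<close>, hence the quadratic bound. A geometric majorant makes the series of derivatives
  converge uniformly on a ball, which permits termwise differentiation.\<close>

lemma power_series_remainder_has_derivative:
  fixes b :: "'a::real_normed_vector \<Rightarrow> 'b::banach \<Rightarrow> 'b" and c :: "nat \<Rightarrow> real"
  assumes b: "bounded_bilinear b" and c: "\<And>k. \<bar>c k\<bar> \<le> C ^ k" "\<And>k. k < 3 \<Longrightarrow> c k = 0"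
  obtains \<delta> M g g' where "0 < \<delta>" "g 0 = 0"
    "\<And>D. norm D < \<delta> \<Longrightarrow> (\<lambda>k. c k *\<^sub>R iter_op b v k D) sums g D"
    "\<And>D. norm D < \<delta> \<Longrightarrow> (g has_derivative g' D) (at D)"
    "\<And>D H. norm D < \<delta> \<Longrightarrow> norm (g' D H) \<le> M * (norm D)\<^sup>2 * norm H"
proof -
  obtain K where K: "0 < K" "\<And>x y. norm (b x y) \<le> norm x * norm y * K"
    using bounded_bilinear.pos_bounded[OF b] by blast
  have K': "0 \<le> K" "\<And>x y. norm (b x y) \<le> K * norm x * norm y"
    using K by (auto simp: mult_ac)
  \<comment> \<open>\<open>L\<close> absorbs both the growth rate \<open>C\<close> of the
    coefficients and the bound \<open>K\<close> of \<open>b\<close>. Having \<open>1 \<le> L\<close>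
    ensures \<open>\<delta> \<le> 1\<close> below.\<close>
  define L where "L = max 1 (max C 0 * K)"
  have C: "\<bar>c k\<bar> * K ^ k \<le> L ^ k" for k
  proof -
    have "C ^ k \<le> (max C 0) ^ k"
      using c(1)[of 1] by (intro power_mono) auto
    then have "\<bar>c k\<bar> * K ^ k \<le> (max C 0) ^ k * K ^ k"
      using c(1)[of k] K(1) by (intro mult_right_mono) auto
    also have "\<dots> \<le> L ^ k"
      unfolding power_mult_distrib[symmetric] L_def using K(1) by (intro power_mono) auto
    finally show ?thesis .
  qed
  have "1 \<le> L"
    by (simp add: L_def)
  \<comment> \<open>On this ball \<open>L * norm D\<close> is at most 1/4, which beats the factor
    \<open>real k \<le> 2 ^ k\<close> and leaves a geometric series of ratio 1/2.\<close>
  define \<delta> where "\<delta> = 1 / (4 * L)"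
  have \<delta>: "0 < \<delta>" "\<delta> \<le> 1"
    using \<open>1 \<le> L\<close> by (auto simp: \<delta>_def field_simps)
  \<comment> \<open>For k = m + 3, m powers of \<open>L\<close> pair with powers of
    \<open>norm D\<close>, and \<open>L ^ 3 * (norm D)\<^sup>2\<close> remains. The 64 is
    \<open>4 ^ 3\<close>, the price of replacing \<open>(1/4) ^ m\<close> by
    \<open>(1/4) ^ k\<close>.\<close>
  define M0 where "M0 = 64 * L ^ 3 * norm v"
  have "0 \<le> M0"
    using \<open>1 \<le> L\<close> by (simp add: M0_def)
  define f' where "f' k D H = c k *\<^sub>R iter_op_deriv b v k D H" for k D H
  have bound: "norm (f' k D H) \<le> M0 * (norm D)\<^sup>2 * norm H * (1/2) ^ k" if D: "norm D < \<delta>" for k D H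
  proof (cases "k < 3")
    case True
    then show ?thesis
      using c(2) \<open>0 \<le> M0\<close> by (simp add: f'_def)
  next
    case False
    then obtain m where m: "k = m + 3"
      by (metis add.commute le_Suc_ex not_less)
    have "norm (f' k D H) \<le> \<bar>c k\<bar> * (real k * K ^ k * norm D ^ (k - 1) * norm H * norm v)"
      unfolding f'_def norm_scaleR by (intro mult_left_mono iter_op_bounds K') auto
    also have "\<dots> = (\<bar>c k\<bar> * K ^ k) * (real k * norm D ^ (k - 1) * norm H * norm v)"
      by simp
    also have "\<dots> \<le> L ^ k * (real k * norm D ^ (k - 1) * norm H * norm v)"
      by (intro mult_right_mono C) auto
    also have "\<dots> = real k * (L * norm D) ^ m * (L ^ 3 * (norm D)\<^sup>2 * norm H * norm v)"
      by (simp add: m power_add power_mult_distrib power2_eq_square power3_eq_cube)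
    also have "\<dots> \<le> 2 ^ k * (1 / 4) ^ m * (L ^ 3 * (norm D)\<^sup>2 * norm H * norm v)"
    proof (intro mult_right_mono mult_mono power_mono)
      show "real k \<le> 2 ^ k"
        by (rule less_imp_le) (rule of_nat_less_two_power)
      show "L * norm D \<le> 1 / 4"
        using D \<open>1 \<le> L\<close> by (simp add: \<delta>_def field_simps)
    qed (use \<open>1 \<le> L\<close> in auto)
    also have "(2::real) ^ k * (1 / 4) ^ m = 64 * (1 / 2) ^ k"
    proof -
      have "(1 / 4 :: real) ^ m = (1/2) ^ m * (1/2) ^ m"
        by (simp flip: power_mult_distrib)
      then show ?thesis
        by (simp add: m power_add power_divide)
    qed
    finally show ?thesis
      by (simp add: M0_def mult_ac)
  qed
  define g' where "g' D H = (\<Sum>k. f' k D H)" for D H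
  have geo: "summable (\<lambda>k. M0 * (norm D)\<^sup>2 * norm H * (1/2::real) ^ k)" for D :: 'a and H :: 'a
    by (intro summable_mult summable_geometric) simp
  have summ: "summable (\<lambda>k. norm (f' k D H))" if "norm D < \<delta>" for D H
    using bound[OF that] by (intro summable_comparison_test'[OF geo[of D H]]) auto
  have g'_bound: "norm (g' D H) \<le> 2 * M0 * (norm D)\<^sup>2 * norm H" if D: "norm D < \<delta>" for D H
  proof -
    have "norm (g' D H) \<le> (\<Sum>k. norm (f' k D H))"
      unfolding g'_def by (rule summable_norm[OF summ[OF D]])
    also have "\<dots> \<le> (\<Sum>k. M0 * (norm D)\<^sup>2 * norm H * (1/2) ^ k)"
      by (intro suminf_le bound[OF D] summ[OF D] geo)
    also have "\<dots> = 2 * M0 * (norm D)\<^sup>2 * norm H"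
      by (subst suminf_mult) (auto simp: suminf_geometric)
    finally show ?thesis .
  qed
  \<comment> \<open>Bounding \<open>(norm D)\<^sup>2\<close> by 1 makes the tail estimate uniform
    over the ball.\<close>
  have tail: "norm ((\<Sum>k<n. f' k D H) - g' D H) \<le> 2 * M0 * (1/2) ^ n * norm H"
    if D: "norm D < \<delta>" for D H n
  proof -
    have s: "summable (\<lambda>k. f' k D H)"
      using summable_norm_cancel[OF summ[OF D]] .
    have "norm ((\<Sum>k<n. f' k D H) - g' D H) = norm (\<Sum>k. f' (k + n) D H)"
      unfolding g'_def using suminf_minus_initial_segment[OF s, of n] by (simp add: norm_minus_commute)
    also have "\<dots> \<le> (\<Sum>k. norm (f' (k + n) D H))"
      by (intro summable_norm summable_ignore_initial_segment[OF summ[OF D]])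
    also have "\<dots> \<le> (\<Sum>k. M0 * norm H * (1/2) ^ n * (1/2) ^ k)"
    proof (intro suminf_le summable_ignore_initial_segment[OF summ[OF D]] summable_mult
        summable_geometric)
      fix k
      have "norm (f' (k + n) D H) \<le> M0 * (norm D)\<^sup>2 * norm H * (1/2) ^ (k + n)"
        by (rule bound[OF D])
      also have "\<dots> \<le> M0 * 1 * norm H * (1/2) ^ (k + n)"
        using D \<delta> \<open>0 \<le> M0\<close> by (intro mult_right_mono mult_left_mono) (auto simp: power_le_one)
      finally show "norm (f' (k + n) D H) \<le> M0 * norm H * (1/2) ^ n * (1/2) ^ k"
        by (simp add: power_add mult_ac)
    qed simp
    also have "\<dots> = 2 * M0 * (1/2) ^ n * norm H"
      by (subst suminf_mult) (auto simp: suminf_geometric)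
    finally show ?thesis .
  qed
  \<comment> \<open>At 0 the term k = 0 vanishes by its coefficient and the others by bilinearity.
    Termwise differentiation requires convergence at one point, and 0 is that point.\<close>
  have z: "c k *\<^sub>R iter_op b v k 0 = 0" for k
    using c(2)[of 0] bounded_bilinear.zero_left[OF b] by (cases k) auto
  have "\<exists>g. \<forall>D\<in>ball 0 \<delta>. (\<lambda>k. c k *\<^sub>R iter_op b v k D) sums g D \<and>
      (g has_derivative g' D) (at D within ball 0 \<delta>)"
  proof (rule has_derivative_series)
    show "((\<lambda>D. c k *\<^sub>R iter_op b v k D) has_derivative f' k D) (at D within ball 0 \<delta>)" for k D
      unfolding f'_def by (intro has_derivative_scaleR_right iter_op_has_derivative b)
    show "\<forall>\<^sub>F n in sequentially. \<forall>D\<in>ball 0 \<delta>. \<forall>H.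
        norm ((\<Sum>k<n. f' k D H) - g' D H) \<le> e * norm H" if "e > 0" for e
    proof -
      have "(\<lambda>n. 2 * M0 * (1/2) ^ n) \<longlonglongrightarrow> 2 * M0 * 0"
        by (intro tendsto_intros LIMSEQ_power_zero) simp
      then have "\<forall>\<^sub>F n in sequentially. 2 * M0 * (1/2) ^ n < e"
        using that by (auto dest: order_tendstoD)
      then show ?thesis
      proof eventually_elim
        case (elim n)
        show ?case
        proof safe
          fix D H :: 'a
          assume "D \<in> ball 0 \<delta>"
          then have "norm ((\<Sum>k<n. f' k D H) - g' D H) \<le> 2 * M0 * (1/2) ^ n * norm H"
            by (intro tail) auto
          also have "\<dots> \<le> e * norm H"
            using elim by (intro mult_right_mono) auto
          finally show "norm ((\<Sum>k<n. f' k D H) - g' D H) \<le> e * norm H" .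
        qed
      qed
    qed
    show "(0::'a) \<in> ball 0 \<delta>"
      using \<delta> by simp
    show "(\<lambda>k. c k *\<^sub>R iter_op b v k 0) sums 0"
      unfolding z by (rule sums_zero)
  qed simp
  then obtain g where g: "\<And>D. norm D < \<delta> \<Longrightarrow> (\<lambda>k. c k *\<^sub>R iter_op b v k D) sums g D"
    "\<And>D. norm D < \<delta> \<Longrightarrow> (g has_derivative g' D) (at D within ball 0 \<delta>)"
    unfolding Ball_def mem_ball_0 by blast
  have "(g has_derivative g' D) (at D)" if "norm D < \<delta>" for D
    using g(2)[OF that] that by (simp add: at_within_open[OF _ open_ball])
  moreover have "g 0 = 0"
    using g(1)[of 0] \<delta>(1) unfolding z by (simp add: sums_unique2[OF _ sums_zero])
  ultimately show thesis
    using \<delta>(1) g(1) g'_bound that by blast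
qed

text \<open>The quotient of consecutive coefficients is (s - k) / (k + 1), whose absolute value is
  at most \<open>\<bar>s\<bar> + 1\<close>.\<close>

lemma abs_gbinomial_le: "\<bar>s gchoose k\<bar> \<le> (\<bar>s\<bar> + 1) ^ k" for s :: real
proof (induction k)
  case (Suc k)
  have "\<bar>s - real k\<bar> \<le> \<bar>s\<bar> + real k"
    by simp
  also have "\<dots> \<le> (\<bar>s\<bar> + 1) * (real k + 1)"
    by (simp add: algebra_simps)
  finally have q: "\<bar>(s - real k) / (real k + 1)\<bar> \<le> \<bar>s\<bar> + 1"
    by (simp add: divide_simps)
  have "(real k + 1) * (s gchoose Suc k) = (s - real k) * (s gchoose k)"
    using gbinomial_absorb_comp[of s k] gbinomial_absorption[of k s]
    by (simp add: algebra_simps gbinomial_mult_1)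
  then have "s gchoose Suc k = ((s - real k) / (real k + 1)) * (s gchoose k)"
    by (simp add: field_simps)
  then have "\<bar>s gchoose Suc k\<bar> = \<bar>(s - real k) / (real k + 1)\<bar> * \<bar>s gchoose k\<bar>"
    by (simp add: abs_mult)
  also have "\<dots> \<le> (\<bar>s\<bar> + 1) * (\<bar>s\<bar> + 1) ^ k"
    using q Suc by (intro mult_mono) auto
  finally show ?case
    by simp
qed simp

section \<open>Derivatives of curves at 0\<close>

lemma has_vector_derivative_at_0_iff:
  "(f has_vector_derivative f') (at 0) \<longleftrightarrow> ((\<lambda>t. (f t - f 0) /\<^sub>R t) \<longlongrightarrow> f') (at 0)"
proof -
  have "((\<lambda>t. (f t - f 0) /\<^sub>R t) \<longlongrightarrow> f') (at 0) \<longleftrightarrow>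
      ((\<lambda>t. norm ((f t - f 0) /\<^sub>R t - f')) \<longlongrightarrow> 0) (at 0)"
    by (simp add: tendsto_norm_zero_iff LIM_zero_iff)
  also have "\<dots> \<longleftrightarrow> ((\<lambda>t. norm (f t - f 0 - (t - 0) *\<^sub>R f') / norm (t - 0)) \<longlongrightarrow> 0) (at 0)"
  proof (intro filterlim_cong refl)
    have "norm ((f t - f 0) /\<^sub>R t - f') = norm (f t - f 0 - (t - 0) *\<^sub>R f') / norm (t - 0)"
      if "t \<noteq> 0" for t
    proof -
      have "(f t - f 0) /\<^sub>R t - f' = (1 / t) *\<^sub>R (f t - f 0 - (t - 0) *\<^sub>R f')"
        using that by (simp add: scaleR_diff_right divide_inverse)
      then show ?thesis
        by simp
    qed
    then show "\<forall>\<^sub>F t in at 0. norm ((f t - f 0) /\<^sub>R t - f') =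
        norm (f t - f 0 - (t - 0) *\<^sub>R f') / norm (t - 0)"
      by (simp add: eventually_at_filter)
  qed
  finally show ?thesis
    by (simp add: has_vector_derivative_def has_derivative_iff_norm bounded_linear_scaleR_left)
qed

text \<open>Dividing by \<open>t\<close> turns one factor \<open>norm (D t)\<close> into a
  convergent difference quotient, while the other tends to 0. Applied to the first derivative of the
  series remainder along a curve, this settles its second-order contribution without differentiating
  the series twice.\<close>

lemma has_vector_derivative_zero_of_quadratic_bound:
  fixes f :: "real \<Rightarrow> 'a::real_normed_vector" and D :: "real \<Rightarrow> 'b::real_normed_vector"
    and B :: "real \<Rightarrow> 'c::real_normed_vector"
  assumes bound: "\<forall>\<^sub>F t in nhds 0. norm (f t) \<le> M * (norm (D t))\<^sup>2 * norm (B t)"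
    and D: "(D has_vector_derivative D') (at 0)" "D 0 = 0" and B: "isCont B 0"
  shows "(f has_vector_derivative 0) (at 0)"
proof -
  \<comment> \<open>The bound is assumed on \<open>nhds 0\<close>, so it holds at 0 itself.\<close>
  have f0: "f 0 = 0"
    using eventually_nhds_x_imp_x[OF bound] D(2) by simp
  have Dq: "((\<lambda>t. D t /\<^sub>R t) \<longlongrightarrow> D') (at 0)"
    using D by (simp add: has_vector_derivative_at_0_iff)
  have Dc: "(D \<longlongrightarrow> 0) (at 0)"
    using has_vector_derivative_continuous[OF D(1)] D(2) by (simp add: continuous_within)
  have "((\<lambda>t. M * (norm (D t /\<^sub>R t) * norm (D t)) * norm (B t)) \<longlongrightarrow>
      M * (norm D' * norm (0::'b)) * norm (B 0)) (at 0)"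
    using B by (intro tendsto_intros Dq Dc) (auto simp: isCont_def)
  then have lim: "((\<lambda>t. M * (norm (D t /\<^sub>R t) * norm (D t)) * norm (B t)) \<longlongrightarrow> 0) (at 0)"
    by simp
  have "\<forall>\<^sub>F t in at 0. norm (f t /\<^sub>R t) \<le> M * (norm (D t /\<^sub>R t) * norm (D t)) * norm (B t)"
    using filter_leD[OF at_within_le_nhds bound]
  proof eventually_elim
    case (elim t)
    then have "norm (f t) / \<bar>t\<bar> \<le> (M * (norm (D t))\<^sup>2 * norm (B t)) / \<bar>t\<bar>"
      by (intro divide_right_mono) auto
    then show ?case
      by (simp add: divide_inverse power2_eq_square mult_ac)
  qed
  from Lim_null_comparison[OF this lim] show ?thesis
    by (simp add: has_vector_derivative_at_0_iff f0)
qed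

subsection \<open>Binomial expansion of the trace functional\<close>

lemma matrix_inv:
  assumes "invertible A"
  shows "A ** matrix_inv A = mat 1" "matrix_inv A ** A = mat 1"
proof -
  have "A ** matrix_inv A = mat 1 \<and> matrix_inv A ** A = mat 1"
    unfolding matrix_inv_def by (rule someI_ex) (use assms in \<open>simp add: invertible_def\<close>)
  then show "A ** matrix_inv A = mat 1" "matrix_inv A ** A = mat 1"
    by auto
qed

lemma pos_def_invertible:
  fixes A :: "complex^'n^'n"
  assumes "pos_def A"
  shows "invertible A"
proof -
  have "x = 0" if "A *v x = 0" for x
    using assms that unfolding pos_def_def Re_quad_form by (metis inner_zero_right less_irrefl)
  then show ?thesis
    unfolding invertible_left_inverse matrix_left_invertible_ker by blast
qed

lemma hermitian_matrix_inv:
  assumes "hermitian A" "invertible A"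
  shows "hermitian (matrix_inv A)"
proof -
  have "conj_transpose (matrix_inv A) ** A = conj_transpose (A ** matrix_inv A)"
    using assms(1) by (simp add: conj_transpose_mult hermitian_def)
  then have "conj_transpose (matrix_inv A) ** A ** matrix_inv A = matrix_inv A"
    by (simp add: matrix_inv[OF assms(2)])
  then show ?thesis
    by (simp add: matrix_inv[OF assms(2)] hermitian_def flip: matrix_mul_assoc)
qed

lemma linear_trace: "linear (\<lambda>X. Re (trace (X :: complex^'n^'n)))"
  by (rule linearI) (simp_all add: trace_def sum.distrib sum_distrib_left)

lemma bounded_linear_Re_trace: "bounded_linear (\<lambda>X. Re (trace (X :: complex^'n^'n)))"
  using linear_trace by (simp add: linear_conv_bounded_linear)

lemma bounded_bilinear_matrix_sandwich:
  fixes A :: "complex^'n^'n"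
  shows "bounded_bilinear (\<lambda>X Y. X ** A ** Y :: complex^'n^'n)"
proof -
  have "linear (\<lambda>X :: complex^'n^'n. X ** A ** Y)" "linear (\<lambda>X :: complex^'n^'n. Y ** A ** X)"
    for Y :: "complex^'n^'n"
    by (rule linearI; simp add: vec_eq_iff matrix_matrix_mult_def sum.distrib algebra_simps
        sum_distrib_left sum_distrib_right scaleR_sum_right)+
  then show ?thesis
    by (simp add: bilinear_def flip: bilinear_conv_bounded_bilinear)
qed

lemma bounded_bilinear_Re_trace_sandwich:
  fixes A :: "complex^'n^'n"
  shows "bounded_bilinear (\<lambda>X Y. Re (trace (X ** A ** Y :: complex^'n^'n)))"
proof -
  interpret b: bounded_bilinear "\<lambda>X Y. X ** A ** Y :: complex^'n^'n"
    by (rule bounded_bilinear_matrix_sandwich)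
  have "linear (\<lambda>X. Re (trace (X ** A ** Y)))" "linear (\<lambda>X. Re (trace (Y ** A ** X)))"
    for Y :: "complex^'n^'n"
    using linear_compose[OF bounded_linear.linear[OF b.bounded_linear_left] linear_trace]
      linear_compose[OF bounded_linear.linear[OF b.bounded_linear_right] linear_trace]
    by (simp_all add: o_def)
  then show ?thesis
    by (simp add: bilinear_def flip: bilinear_conv_bounded_bilinear)
qed

abbreviation inv_sandwich :: "complex^'n^'n \<Rightarrow> complex^'n^'n \<Rightarrow> complex^'n^'n \<Rightarrow> complex^'n^'n" where
  "inv_sandwich \<rho> X Y \<equiv> X ** matrix_inv \<rho> ** Y"

abbreviation geometric_trace :: "real \<Rightarrow> complex^'n^'n \<Rightarrow> complex^'n^'n \<Rightarrow> real" where
  "geometric_trace \<alpha> \<rho> \<sigma> \<equiv> Re (trace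
     (\<sigma> ** matrix_powr (matrix_powr \<sigma> (-1/2) ** \<rho> ** matrix_powr \<sigma> (-1/2)) \<alpha>))"

text \<open>
  This is the alternative form \<open>Tr[\<rho> (\<sigma> \<rho>\<^sup>-\<^sup>1) powr (1 - \<alpha>)]\<close> of the trace functional, expanded in
  the binomial series around \<open>\<sigma> = \<rho>\<close>; it involves no inverse or power of the varying \<open>\<sigma>\<close>.
\<close>

lemma geometric_trace_series:
  fixes \<rho> \<sigma> :: "complex^'n^'n"
  assumes pd: "pos_def \<rho>" "pos_def \<sigma>"
    and K: "\<And>X Y. norm (inv_sandwich \<rho> X Y) \<le> K * norm X * norm Y"
    and small: "K * norm (\<sigma> - \<rho>) < 1"
  shows "(\<lambda>k. ((1 - \<alpha>) gchoose k) * Re (trace (iter_op (inv_sandwich \<rho>) \<rho> k (\<sigma> - \<rho>))))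
      sums geometric_trace \<alpha> \<rho> \<sigma>" (is ?sums)
    and "0 < geometric_trace \<alpha> \<rho> \<sigma>" (is ?pos)
proof -
  obtain T :: "complex^'n^'n" and d where T: "invertible T" and d: "\<And>i. 0 < d i"
    and \<sigma>: "\<sigma> = T ** conj_transpose T" and \<rho>: "\<rho> = T ** real_diag d ** conj_transpose T"
    and tr: "\<And>\<alpha>. trace (\<sigma> ** matrix_powr (matrix_powr \<sigma> (-1/2) ** \<rho> ** matrix_powr \<sigma> (-1/2)) \<alpha>) =
      trace (T ** real_diag (\<lambda>i. d i powr \<alpha>) ** conj_transpose T)"
    using simultaneous_diagonalization_geometric[OF pd] by metis
  define D where "D = \<sigma> - \<rho>"
  \<comment> \<open>These turn out to be the eigenvalues of \<open>D ** matrix_inv \<rho>\<close>,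
    with the columns of \<open>T\<close> as eigenvectors (fact \<open>DT\<close>).\<close>
  define z where "z i = 1 / d i - 1" for i
  define w where "w i = (\<Sum>j\<in>UNIV. (cmod (T $ j $ i))\<^sup>2)" for i
  obtain S where "S ** T = mat 1" "T ** S = mat 1"
    using T by (auto simp: invertible_def)
  then have S: "conj_transpose T ** conj_transpose S = mat 1"
    by (simp flip: conj_transpose_mult)
  have \<rho>inv: "matrix_inv \<rho> ** \<rho> = mat 1"
    using matrix_inv pos_def_invertible pd(1) by blast
  define E where "E = conj_transpose S ** real_diag (\<lambda>i. 1 / d i)"
  have "\<rho> ** E = T ** real_diag d ** (conj_transpose T ** conj_transpose S) ** real_diag (\<lambda>i. 1 / d i)"
    by (simp only: \<rho> E_def matrix_mul_assoc)
  also have "\<dots> = T ** (real_diag d ** real_diag (\<lambda>i. 1 / d i))"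
    by (simp only: S matrix_mul_rid matrix_mul_assoc)
  also have "\<dots> = T"
    using d by (simp add: real_diag_mult real_diag_one less_imp_neq[symmetric])
  finally have "matrix_inv \<rho> ** T = (matrix_inv \<rho> ** \<rho>) ** E"
    by (simp flip: matrix_mul_assoc)
  then have T_E: "matrix_inv \<rho> ** T = E"
    by (simp add: \<rho>inv)
  have "D = T ** real_diag (\<lambda>i. 1 - d i) ** conj_transpose T"
    by (simp add: D_def \<sigma> \<rho> matrix_diff_ldistrib matrix_diff_rdistrib real_diag_one
        flip: real_diag_diff)
  then have "D ** E = T ** real_diag (\<lambda>i. 1 - d i) ** (conj_transpose T ** conj_transpose S) **
      real_diag (\<lambda>i. 1 / d i)"
    by (simp only: E_def matrix_mul_assoc)
  also have "\<dots> = T ** (real_diag (\<lambda>i. 1 - d i) ** real_diag (\<lambda>i. 1 / d i))"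
    by (simp only: S matrix_mul_rid matrix_mul_assoc)
  also have "\<dots> = T ** real_diag z"
    using d by (simp add: real_diag_mult z_def[abs_def] field_simps less_imp_neq[symmetric])
  finally have DT: "D ** matrix_inv \<rho> ** T = T ** real_diag z"
    by (simp add: T_E flip: matrix_mul_assoc)
  have D_step: "inv_sandwich \<rho> D (T ** real_diag e ** X) = T ** real_diag (\<lambda>i. z i * e i) ** X" for e X
    by (simp add: matrix_mul_assoc DT flip: real_diag_mult)
  have P: "iter_op (inv_sandwich \<rho>) \<rho> k D = T ** real_diag (\<lambda>i. z i ^ k * d i) ** conj_transpose T" for k
    by (induction k) (simp_all add: D_step \<rho>[symmetric] mult.assoc)
  have P_tr: "Re (trace (iter_op (inv_sandwich \<rho>) \<rho> k D)) = (\<Sum>i\<in>UNIV. z i ^ k * d i * w i)" for k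
    by (simp add: P trace_congruence_real_diag w_def)
  have z: "\<bar>z i\<bar> < 1" for i
  proof -
    \<comment> \<open>\<open>X\<close> keeps column i of \<open>T\<close> and clears the rest, so it
      is an eigenvector of the map \<open>inv_sandwich \<rho> D\<close> for the eigenvalue
      \<open>z i\<close>. The bound \<open>K\<close> on that map then bounds the eigenvalue.\<close>
    define X where "X = T ** real_diag (\<lambda>k. if k = i then 1 else 0) ** mat 1"
    have "X \<noteq> 0"
    proof
      assume "X = 0"
      then have "S ** X = 0"
        by (simp add: matrix_matrix_mult_def vec_eq_iff)
      then have "real_diag (\<lambda>k. if k = i then 1 else 0) = (0 :: complex^'n^'n)"
        using \<open>S ** T = mat 1\<close> by (simp add: X_def matrix_mul_assoc)
      then have "real_diag (\<lambda>k. if k = i then 1 else 0) $ i $ i = (0 :: complex^'n^'n) $ i $ i"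
        by simp
      then show False
        by (simp add: real_diag_def)
    qed
    have "inv_sandwich \<rho> D X = T ** real_diag (\<lambda>k. z k * (if k = i then 1 else 0)) ** mat 1"
      unfolding X_def by (rule D_step)
    also have "\<dots> = z i *\<^sub>R X"
      by (auto simp: X_def vec_eq_iff real_diag_mult_right scaleR_conv_of_real[where 'a = complex])
    finally have "\<bar>z i\<bar> * norm X \<le> K * norm D * norm X"
      using K[of D X] by simp
    then have "\<bar>z i\<bar> \<le> K * norm D"
      using \<open>X \<noteq> 0\<close> by simp
    with small show ?thesis
      by (simp add: D_def)
  qed
  have tr': "geometric_trace \<alpha> \<rho> \<sigma> = (\<Sum>i\<in>UNIV. d i powr \<alpha> * w i)"
    by (simp only: tr trace_congruence_real_diag w_def)
  have sums: "(\<lambda>k. \<Sum>i\<in>UNIV. (((1 - \<alpha>) gchoose k) * z i ^ k) * (d i * w i)) sums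
      (\<Sum>i\<in>UNIV. ((1 + z i) powr (1 - \<alpha>)) * (d i * w i))"
    by (intro sums_sum sums_mult2 gen_binomial_real z)
  \<comment> \<open>Since \<open>1 + z i = 1 / d i\<close>, the power equals
    \<open>d i powr (\<alpha> - 1)\<close>, and the extra factor \<open>d i\<close> comes from
    \<rho>.\<close>
  have eq: "(1 + z i) powr (1 - \<alpha>) * (d i * w i) = d i powr \<alpha> * w i" for i
    using d[of i] by (simp add: z_def powr_diff powr_divide)
  show ?sums
    using sums unfolding eq tr' D_def[symmetric] P_tr sum_distrib_left by (simp add: mult_ac)
  have "0 < w i" for i
  proof -
    have "\<exists>j. T $ j $ i \<noteq> 0"
    proof (rule ccontr)
      assume "\<not> ?thesis"
      then have "(S ** T) $ i $ i = 0"
        by (simp add: matrix_matrix_mult_def)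
      with \<open>S ** T = mat 1\<close> show False
        by (simp add: mat_def)
    qed
    then obtain j where "T $ j $ i \<noteq> 0" ..
    then show ?thesis
      unfolding w_def by (intro sum_pos2[of _ j]) auto
  qed
  with d show ?pos
    unfolding tr' by (intro sum_pos mult_pos_pos) (auto simp: less_imp_neq[symmetric])
qed

text \<open>The binomial series is cut after degree 2. The remainder \<open>R\<close> is a function
  of an arbitrary small matrix, not only of differences of states, so the chain rule applies to
  it.\<close>

lemma geometric_trace_local_expansion:
  fixes \<rho> :: "complex^'n^'n"
  assumes pd: "pos_def \<rho>" and tr: "trace \<rho> = 1"
  obtains \<delta> M R R' where "0 < \<delta>" "R 0 = 0"
    "\<And>D. norm D < \<delta> \<Longrightarrow> (R has_derivative R' D) (at D)"
    "\<And>D H. norm D < \<delta> \<Longrightarrow> \<bar>R' D H\<bar> \<le> M * (norm D)\<^sup>2 * norm H"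
    "\<And>\<sigma>. pos_def \<sigma> \<Longrightarrow> trace \<sigma> = 1 \<Longrightarrow> norm (\<sigma> - \<rho>) < \<delta> \<Longrightarrow>
      geometric_trace \<alpha> \<rho> \<sigma> =
        1 + \<alpha> * (\<alpha> - 1) / 2 * Re (trace (inv_sandwich \<rho> (\<sigma> - \<rho>) (\<sigma> - \<rho>))) + R (\<sigma> - \<rho>)"
    "\<And>\<sigma>. pos_def \<sigma> \<Longrightarrow> norm (\<sigma> - \<rho>) < \<delta> \<Longrightarrow> 0 < geometric_trace \<alpha> \<rho> \<sigma>"
proof -
  let ?b = "inv_sandwich \<rho>"
  define s where "s = 1 - \<alpha>"
  have b: "bounded_bilinear ?b"
    by (rule bounded_bilinear_matrix_sandwich)
  then obtain K where K: "0 < K" "\<And>X Y. norm (?b X Y) \<le> norm X * norm Y * K"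
    using bounded_bilinear.pos_bounded by blast
  obtain L where L: "0 < L" "\<And>X :: complex^'n^'n. \<bar>Re (trace X)\<bar> \<le> norm X * L"
    using bounded_linear.pos_bounded[OF bounded_linear_Re_trace[where 'n = 'n]] by auto
  define c where "c k = (if k < 3 then 0 else s gchoose k)" for k
  have c: "\<bar>c k\<bar> \<le> (\<bar>s\<bar> + 1) ^ k" for k
    using abs_gbinomial_le[of s k] by (auto simp: c_def)
  have c0: "c k = 0" if "k < 3" for k
    using that by (simp add: c_def)
  obtain \<delta> M g g' where \<delta>: "0 < \<delta>" and g0: "g 0 = 0"
    and g: "\<And>D. norm D < \<delta> \<Longrightarrow> (\<lambda>k. c k *\<^sub>R iter_op ?b \<rho> k D) sums g D"
    and g': "\<And>D. norm D < \<delta> \<Longrightarrow> (g has_derivative g' D) (at D)"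
    and M: "\<And>D H. norm D < \<delta> \<Longrightarrow> norm (g' D H) \<le> M * (norm D)\<^sup>2 * norm H"
    by (rule power_series_remainder_has_derivative[OF b c c0, of \<rho>], assumption) (rule that)
  define R where "R D = Re (trace (g D))" for D
  define R' where "R' D H = Re (trace (g' D H))" for D H
  define \<delta>' where "\<delta>' = min \<delta> (1 / K)"
  have K': "norm (?b X Y) \<le> K * norm X * norm Y" for X Y
    using K(2)[of X Y] by (simp add: mult_ac)
  have small: "K * norm D < 1" "norm D < \<delta>" if "norm D < \<delta>'" for D :: "complex^'n^'n"
    using that K(1) by (simp_all add: \<delta>'_def field_simps)
  show thesis
  proof (rule that[of \<delta>' R R' "L * M"])
    show "0 < \<delta>'" "R 0 = 0"
      using \<delta> K(1) g0 linear_0[OF linear_trace] by (simp_all add: \<delta>'_def R_def)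
    show "(R has_derivative R' D) (at D)" if "norm D < \<delta>'" for D
      unfolding R_def R'_def
      by (intro bounded_linear.has_derivative[OF bounded_linear_Re_trace] g' small that)
    show "\<bar>R' D H\<bar> \<le> (L * M) * (norm D)\<^sup>2 * norm H" if "norm D < \<delta>'" for D H
    proof -
      have "\<bar>R' D H\<bar> \<le> norm (g' D H) * L"
        unfolding R'_def by (rule L)
      also have "\<dots> \<le> (M * (norm D)\<^sup>2 * norm H) * L"
        using L(1) by (intro mult_right_mono M small that) auto
      finally show ?thesis
        by (simp add: mult_ac)
    qed
    fix \<sigma> :: "complex^'n^'n"
    assume \<sigma>: "pos_def \<sigma>" "norm (\<sigma> - \<rho>) < \<delta>'"
    note series = geometric_trace_series[OF pd \<sigma>(1) K' small(1)[OF \<sigma>(2)], of \<alpha>]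
    from series(2) show "0 < geometric_trace \<alpha> \<rho> \<sigma>" .
    assume tr\<sigma>: "trace \<sigma> = 1"
    define D where "D = \<sigma> - \<rho>"
    define P where "P k = Re (trace (iter_op ?b \<rho> k D))" for k
    \<comment> \<open>Hence the linear term is the trace of \<open>D\<close>, which vanishes because
      both operators have trace 1.\<close>
    have "?b D \<rho> = D"
      using matrix_inv(2)[OF pos_def_invertible[OF pd]] by (simp flip: matrix_mul_assoc)
    then have P_012: "P 0 = 1" "P 1 = 0" "P 2 = Re (trace (?b D D))"
      by (simp_all add: P_def tr numeral_2_eq_2 D_def trace_sub tr\<sigma>)
    have "(\<lambda>k. Re (trace (c k *\<^sub>R iter_op ?b \<rho> k D))) sums R D"
      unfolding R_def using g[OF small(2)[OF \<sigma>(2)]] unfolding D_def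
      by (rule bounded_linear.sums[OF bounded_linear_Re_trace])
    then have "(\<lambda>k. c k * P k) sums R D"
      by (simp add: P_def linear_scale[OF linear_trace])
    \<comment> \<open>Subtracting the remainder series cancels all terms from degree 3 on, so a
      finite sum is left.\<close>
    then have "(\<lambda>k. (s gchoose k) * P k - c k * P k) sums (geometric_trace \<alpha> \<rho> \<sigma> - R D)"
      using series(1) by (intro sums_diff) (simp_all add: P_def D_def s_def)
    moreover have "(\<lambda>k. (s gchoose k) * P k - c k * P k) sums
        (\<Sum>k<3. (s gchoose k) * P k - c k * P k)"
      by (rule sums_finite) (auto simp: c_def)
    ultimately have "geometric_trace \<alpha> \<rho> \<sigma> - R D = (\<Sum>k<3. (s gchoose k) * P k - c k * P k)"
      by (rule sums_unique2)
    also have "\<dots> = P 0 + s * P 1 + s * (s - 1) / 2 * P 2"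
      by (simp add: numeral_3_eq_3 c_def gbinomial_Suc_rec gbinomial_prod_rev eval_nat_numeral)
    also have "\<dots> = 1 + s * (s - 1) / 2 * Re (trace (?b D D))"
      by (simp only: P_012)
    finally show "geometric_trace \<alpha> \<rho> \<sigma> =
        1 + \<alpha> * (\<alpha> - 1) / 2 * Re (trace (?b (\<sigma> - \<rho>) (\<sigma> - \<rho>))) + R (\<sigma> - \<rho>)"
      by (simp add: D_def s_def algebra_simps)
  qed
qed

lemma has_derivative_imp_partial_deriv:
  assumes "(F has_derivative F') (at x)"
  shows "((\<lambda>t. F (x + t *\<^sub>R axis i 1)) has_vector_derivative F' (axis i 1)) (at 0)"
    and "partial_deriv i F x = F' (axis i 1)"
proof -
  have "((\<lambda>t. x + t *\<^sub>R axis i (1::real)) has_derivative (\<lambda>t. t *\<^sub>R axis i 1)) (at 0)"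
    by (auto intro!: derivative_eq_intros)
  moreover have "(F has_derivative F') (at (x + 0 *\<^sub>R axis i 1))"
    using assms by simp
  ultimately have "((\<lambda>t. F (x + t *\<^sub>R axis i 1)) has_derivative (\<lambda>t. F' (t *\<^sub>R axis i 1))) (at 0)"
    by (rule has_derivative_compose)
  also have "(\<lambda>t. F' (t *\<^sub>R axis i 1)) = (\<lambda>t. t *\<^sub>R F' (axis i 1))"
    using linear_scale[OF has_derivative_linear[OF assms]] by auto
  finally show "((\<lambda>t. F (x + t *\<^sub>R axis i 1)) has_vector_derivative F' (axis i 1)) (at 0)"
    by (simp add: has_vector_derivative_def)
  then show "partial_deriv i F x = F' (axis i 1)"
    unfolding partial_deriv_def by (rule vector_derivative_at)
qed

subsection \<open>The second derivative\<close>

lemma linear_conj_transpose: "linear (conj_transpose :: complex^'n^'n \<Rightarrow> complex^'n^'n)"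
  by (rule linearI) (simp_all add: conj_transpose_def vec_eq_iff)

text \<open>Conjugate transposition is real linear and bounded, so it commutes with differentiation
  and fixes the derivative as it fixes the curve.\<close>

lemma has_vector_derivative_hermitian:
  assumes "\<And>t. hermitian (f t)" "(f has_vector_derivative A) (at x)"
  shows "hermitian A"
proof -
  have "bounded_linear (conj_transpose :: complex^'a^'a \<Rightarrow> complex^'a^'a)"
    using linear_conj_transpose by (simp add: linear_conv_bounded_linear)
  from bounded_linear.has_vector_derivative[OF this assms(2)]
  have "(f has_vector_derivative conj_transpose A) (at x)"
    using assms(1) by (simp add: hermitian_def)
  with assms(2) show ?thesis
    unfolding hermitian_def by (metis vector_derivative_unique_at)
qed

text \<open>The two products are conjugate transposes of each other. This symmetry merges the two
  product-rule terms of the quadratic form into twice an RLD entry.\<close>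

lemma Re_trace_inv_sandwich_commute:
  assumes "hermitian A" "hermitian B" "hermitian \<rho>" "invertible \<rho>"
  shows "Re (trace (inv_sandwich \<rho> A B)) = Re (trace (inv_sandwich \<rho> B A))"
proof -
  have "inv_sandwich \<rho> B A = conj_transpose (inv_sandwich \<rho> A B)"
    using assms hermitian_matrix_inv[OF assms(3,4)]
    by (simp add: conj_transpose_mult hermitian_def matrix_mul_assoc)
  then show ?thesis
    by (simp add: trace_conj_transpose)
qed

theorem theorem5:
  fixes \<rho> :: "real^'l \<Rightarrow> complex^'n^'n"
    and \<alpha> :: real and \<theta> :: "real^'l"
  assumes "twice_differentiable \<rho>"
    and "\<And>\<theta>. state (\<rho> \<theta>)"
    and "\<And>\<theta>. pos_def (\<rho> \<theta>)"
    and "\<alpha> \<in> {0<..<1} \<union> {1<..}"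
  shows "geometric_info_matrix \<alpha> \<rho> \<theta> = RLD_info_matrix \<rho> \<theta>"
proof -
  have tr: "trace (\<rho> x) = 1" for x
    using assms(2) by (simp add: state_def)
  obtain \<rho>' :: "real^'l \<Rightarrow> (real^'l) \<Rightarrow>\<^sub>L (complex^'n^'n)" where
    \<rho>': "\<And>x. (\<rho> has_derivative \<rho>' x) (at x)" "\<And>x. \<rho>' differentiable (at x)"
    using assms(1) unfolding twice_differentiable_def by blast
  let ?S = "\<lambda>\<epsilon>. geometric_renyi_entropy \<alpha> (\<rho> \<theta>) (\<rho> (\<theta> + \<epsilon>))"
  define b where "b = (\<lambda>X Y. Re (trace (inv_sandwich (\<rho> \<theta>) X Y)))"
  define \<kappa> where "\<kappa> = \<alpha> * (\<alpha> - 1) / 2"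
  have b: "bounded_bilinear b"
    unfolding b_def by (rule bounded_bilinear_Re_trace_sandwich)
  interpret b: bounded_bilinear b
    by (rule b)
  obtain \<delta> M R R' where \<delta>: "0 < \<delta>" and R0: "R 0 = 0"
    and R': "\<And>D. norm D < \<delta> \<Longrightarrow> (R has_derivative R' D) (at D)"
    and M: "\<And>D H. norm D < \<delta> \<Longrightarrow> \<bar>R' D H\<bar> \<le> M * (norm D)\<^sup>2 * norm H"
    and expand: "\<And>\<sigma>. pos_def \<sigma> \<Longrightarrow> trace \<sigma> = 1 \<Longrightarrow> norm (\<sigma> - \<rho> \<theta>) < \<delta> \<Longrightarrow>
      geometric_trace \<alpha> (\<rho> \<theta>) \<sigma> = 1 + \<kappa> * b (\<sigma> - \<rho> \<theta>) (\<sigma> - \<rho> \<theta>) + R (\<sigma> - \<rho> \<theta>)"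
    and pos: "\<And>\<sigma>. pos_def \<sigma> \<Longrightarrow> norm (\<sigma> - \<rho> \<theta>) < \<delta> \<Longrightarrow> 0 < geometric_trace \<alpha> (\<rho> \<theta>) \<sigma>"
    unfolding b_def \<kappa>_def
    by (rule geometric_trace_local_expansion[OF assms(3) tr, of \<theta> \<alpha>]) blast
  define \<Delta> where "\<Delta> \<epsilon> = \<rho> (\<theta> + \<epsilon>) - \<rho> \<theta>" for \<epsilon>
  define q where "q D = 1 + \<kappa> * b D D + R D" for D
  define q' where "q' D H = \<kappa> * (b D H + b H D) + R' D H" for D H
  have \<Delta>': "(\<Delta> has_derivative \<rho>' (\<theta> + \<epsilon>)) (at \<epsilon>)" for \<epsilon>
  proof -
    have "((\<lambda>\<epsilon>. \<theta> + \<epsilon>) has_derivative (\<lambda>h. h)) (at \<epsilon>)"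
      by (auto intro!: derivative_eq_intros)
    from has_derivative_compose[OF this \<rho>'(1)] show ?thesis
      unfolding \<Delta>_def[abs_def] by (auto intro!: derivative_eq_intros)
  qed
  have "isCont \<Delta> 0"
    using \<Delta>' has_derivative_continuous by blast
  then obtain \<eta> where \<eta>: "0 < \<eta>" "\<And>\<epsilon>. norm \<epsilon> < \<eta> \<Longrightarrow> norm (\<Delta> \<epsilon>) < \<delta>"
    using \<delta> unfolding continuous_at_eps_delta by (auto simp: dist_norm \<Delta>_def)
  have S_eq: "?S \<epsilon> = 1 / (\<alpha> - 1) * ln (q (\<Delta> \<epsilon>))" and q_pos: "0 < q (\<Delta> \<epsilon>)" if "norm \<epsilon> < \<eta>" for \<epsilon>
    using expand[OF assms(3) tr, of "\<theta> + \<epsilon>"] pos[OF assms(3), of "\<theta> + \<epsilon>"] \<eta>(2)[OF that]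
    by (simp_all add: geometric_renyi_entropy_def q_def \<Delta>_def)
  have q'_deriv: "(q has_derivative q' D) (at D)" if "norm D < \<delta>" for D
    unfolding q_def[abs_def] q'_def[abs_def]
    by (auto intro!: derivative_eq_intros b.FDERIV R'[OF that])
  \<comment> \<open>The first derivative is computed on a whole neighbourhood of 0, because it has
    to be differentiated once more.\<close>
  have S': "(?S has_derivative
      (\<lambda>h. 1 / (\<alpha> - 1) * (q' (\<Delta> \<epsilon>) (\<rho>' (\<theta> + \<epsilon>) h) / q (\<Delta> \<epsilon>)))) (at \<epsilon>)"
    if "norm \<epsilon> < \<eta>" for \<epsilon>
  proof (rule has_derivative_transform_within_open[of _ _ _ _ "ball 0 \<eta>"])
    have "((\<lambda>\<epsilon>. q (\<Delta> \<epsilon>)) has_derivative (\<lambda>h. q' (\<Delta> \<epsilon>) (\<rho>' (\<theta> + \<epsilon>) h))) (at \<epsilon>)"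
      by (rule has_derivative_compose[OF \<Delta>' q'_deriv[OF \<eta>(2)[OF that]]])
    from has_derivative_mult_right[OF has_derivative_ln[OF q_pos[OF that] this], of "1 / (\<alpha> - 1)"]
    show "((\<lambda>\<epsilon>. 1 / (\<alpha> - 1) * ln (q (\<Delta> \<epsilon>))) has_derivative
        (\<lambda>h. 1 / (\<alpha> - 1) * (q' (\<Delta> \<epsilon>) (\<rho>' (\<theta> + \<epsilon>) h) / q (\<Delta> \<epsilon>)))) (at \<epsilon>)"
      by (simp add: divide_inverse mult_ac)
  qed (use that S_eq in auto)
  have "geometric_info_matrix \<alpha> \<rho> \<theta> $ i $ j = RLD_info_matrix \<rho> \<theta> $ i $ j" for i j
  proof -
    define D where "D t = \<Delta> (t *\<^sub>R axis i 1)" for t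
    define B where "B t = \<rho>' (\<theta> + t *\<^sub>R axis i 1) (axis j 1)" for t
    define A where "A = \<rho>' \<theta> (axis i 1)"
    have partial: "partial_deriv i \<rho> \<theta> = A" "partial_deriv j \<rho> \<theta> = B 0"
      using has_derivative_imp_partial_deriv(2)[OF \<rho>'(1)] by (simp_all add: A_def B_def)
    have "hermitian (\<rho>' \<theta> (axis k 1))" for k
      by (rule has_vector_derivative_hermitian[OF _
            has_derivative_imp_partial_deriv(1)[OF \<rho>'(1)]])
        (use assms(3) in \<open>simp add: pos_def_def\<close>)
    then have herm: "hermitian A" "hermitian (B 0)"
      by (simp_all add: A_def B_def)
    have D': "(D has_vector_derivative A) (at 0)" and "D 0 = 0"
      using has_derivative_imp_partial_deriv(1)[OF \<Delta>'[of 0], of i]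
      by (simp_all add: D_def[abs_def] A_def \<Delta>_def)
    obtain \<rho>'' where "(\<rho>' has_derivative \<rho>'') (at \<theta>)"
      using \<rho>'(2) by (auto simp: differentiable_def)
    from bounded_linear.has_vector_derivative[OF blinfun.bounded_linear_left
        has_derivative_imp_partial_deriv(1)[OF this]]
    have B': "(B has_vector_derivative \<rho>'' (axis i 1) (axis j 1)) (at 0)"
      unfolding B_def[abs_def] .
    \<comment> \<open>Up to the factor \<open>1 / (\<alpha> - 1)\<close>, the j-th partial
      derivative along axis i is \<open>n t / q (D t)\<close>.\<close>
    define n where "n t = q' (D t) (B t)" for t
    have near: "\<forall>\<^sub>F t in nhds 0. norm (t *\<^sub>R axis i 1 :: real^'l) < \<eta>"
      using \<eta>(1) by (auto simp: eventually_nhds_metric dist_norm intro!: exI[of _ \<eta>])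
    have R'_small: "((\<lambda>t. R' (D t) (B t)) has_vector_derivative 0) (at 0)"
    proof (rule has_vector_derivative_zero_of_quadratic_bound[OF _ D' \<open>D 0 = 0\<close>])
      show "\<forall>\<^sub>F t in nhds 0. norm (R' (D t) (B t)) \<le> M * (norm (D t))\<^sup>2 * norm (B t)"
        using near by eventually_elim (auto simp: D_def intro!: M \<eta>(2))
      show "isCont B 0"
        using has_vector_derivative_continuous[OF B'] .
    qed
    \<comment> \<open>The terms with the second derivative of \<rho> carry a factor
      \<open>D 0 = 0\<close>, so only products of first derivatives survive.\<close>
    have n': "(n has_vector_derivative \<kappa> * (b A (B 0) + b (B 0) A)) (at 0)"
      unfolding n_def[abs_def] q'_def
      using b.has_vector_derivative[OF D' B'] b.has_vector_derivative[OF B' D']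
      by (auto intro!: derivative_eq_intros R'_small simp: \<open>D 0 = 0\<close> b.zero_left b.zero_right)
    have "b (B 0) A = b A (B 0)"
      unfolding b_def using herm assms(3)
      by (intro Re_trace_inv_sandwich_commute pos_def_invertible) (auto simp: pos_def_def)
    with n' have n': "(n has_real_derivative 2 * \<kappa> * b A (B 0)) (at 0)"
      by (simp add: has_real_derivative_iff_has_vector_derivative mult_ac)
    have "n 0 = 0"
      using M[of 0 "B 0"] \<delta> by (simp add: n_def q'_def \<open>D 0 = 0\<close> b.zero_left b.zero_right)
    have "q (D 0) = 1"
      by (simp add: q_def \<open>D 0 = 0\<close> b.zero_left R0)
    have "(q has_derivative q' (D 0)) (at (D 0))"
      using \<delta> by (intro q'_deriv) (simp add: \<open>D 0 = 0\<close>)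
    from has_derivative_compose[OF D'[unfolded has_vector_derivative_def] this]
    have "(\<lambda>t. q (D t)) differentiable (at 0)"
      by (auto simp: differentiable_def)
    \<comment> \<open>The value of \<open>m\<close> is irrelevant: in the quotient rule at 0 it is
      multiplied by \<open>n 0 = 0\<close>.\<close>
    then obtain m where m: "((\<lambda>t. q (D t)) has_real_derivative m) (at 0)"
      by (auto simp: real_differentiable_def)
    have "((\<lambda>t. n t / q (D t)) has_real_derivative 2 * \<kappa> * b A (B 0)) (at 0)"
      using DERIV_divide[OF n' m] \<open>n 0 = 0\<close> \<open>q (D 0) = 1\<close> by simp
    then have "((\<lambda>t. 1 / (\<alpha> - 1) * (n t / q (D t))) has_real_derivative
        1 / (\<alpha> - 1) * (2 * \<kappa> * b A (B 0))) (at 0)"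
      by (rule DERIV_cmult)
    \<comment> \<open>As \<open>2 * \<kappa> = \<alpha> * (\<alpha> - 1)\<close>, the prefactor
      leaves \<alpha>, which the normalization \<open>1 / \<alpha>\<close> of the information matrix
      removes.\<close>
    also have "1 / (\<alpha> - 1) * (2 * \<kappa> * b A (B 0)) = \<alpha> * b A (B 0)"
      using assms(4) by (auto simp: \<kappa>_def)
    finally have deriv: "((\<lambda>t. 1 / (\<alpha> - 1) * (n t / q (D t))) has_vector_derivative \<alpha> * b A (B 0)) (at 0)"
      by (simp add: has_real_derivative_iff_has_vector_derivative)
    have "((\<lambda>t. partial_deriv j ?S (0 + t *\<^sub>R axis i 1)) has_vector_derivative \<alpha> * b A (B 0)) (at 0)"
    proof (rule has_vector_derivative_transform_within_open[OF deriv, of "{-\<eta><..<\<eta>}"])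
      show "1 / (\<alpha> - 1) * (n t / q (D t)) = partial_deriv j ?S (0 + t *\<^sub>R axis i 1)"
        if "t \<in> {-\<eta><..<\<eta>}" for t
        using has_derivative_imp_partial_deriv(2)[OF S', of "t *\<^sub>R axis i 1" j] that
        by (simp add: n_def D_def B_def abs_less_iff)
    qed (use \<eta> in auto)
    then have "partial_deriv i (partial_deriv j ?S) 0 = \<alpha> * b A (B 0)"
      unfolding partial_deriv_def[of i] by (rule vector_derivative_at)
    then show ?thesis
      using assms(4) by (auto simp: geometric_info_matrix_def RLD_info_matrix_def partial b_def)
  qed
  then show ?thesis
    by (simp add: vec_eq_iff)
qed

end
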